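(* Let $\mathcal{G} = (P, X, \leqslant, \leqslant^*, \vartriangleleft)$ be a Gowers space. Endow $X$ with the discrete topology and $X^\omega$ with the product topology. Then every analytic subset of $X^\omega$ is strategically Ramsey.
   Context: For a set $X$, $\mathrm{Seq}(X) = X^{<\omega}\setminus\{\varnothing\}$; $s^\frown x$ is the sequence $s$ extended by the single term $x$. A \emph{Gowers space} is a quintuple $\mathcal{G} = (P, X, \leqslant, \leqslant^*, \vartriangleleft)$, where $P$ is a nonempty set, $X$ is an at most countable nonempty set, $\leqslant$ and $\leqslant^*$ are quasiorders on $P$, and $\vartriangleleft\ \subseteq \mathrm{Seq}(X)\times P$, such that: (1) for all $p,q\in P$, if $p\leqslant q$ then $p\leqslant^* q$; (2) for all $p,q\in P$, if $p\leqslant^* q$ then there is $r\in P$ with $r\leqslant p$, $r\leqslant q$ and $p\leqslant^* r$; (3) for every $\leqslant$-decreasing sequence $(p_i)_{i\in\omega}$ in $P$ there is $p^*\in P$ with $p^*\leqslant^* p_i$ for all $i$; (4) for every $p\in P$ and $s\in X^{<\omega}$ there is $x\in X$ with $s^\frown x\vartriangleleft p$; (5) for every $s\in\mathrm{Seq}(X)$ and $p,q\in P$, if $s\vartriangleleft p$ and $p\leqslant q$ then $s\vartriangleleft q$. Write $p\lessapprox q$ when $p\leqslant q$ and $q\leqslant^* p$. For $p\in P$, \emph{Gowers' game} $G_p$ is the game in which I and II alternate: I plays $p_0$, II plays $x_0$, I plays $p_1$, II plays $x_1$, etc., with $p_i\in P$, $x_i\in X$. Rule for I: $p_i\leqslant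 p$ for all $i$. Rule for II: $(x_0,\ldots,x_i)\vartriangleleft p_i$ for all $i$. The outcome is $(x_i)_{i\in\omega}\in X^\omega$. The \emph{asymptotic game} $F_p$ is defined in the same way except that I is moreover required to play $p_i\lessapprox p$. A player \emph{has a strategy to reach} a set $\mathcal{Y}$ in a game if she/he has a winning strategy in the game with those rules and whose winning condition for that player is that the outcome belongs to $\mathcal{Y}$. A set $\mathcal{X}\subseteq X^\omega$ is \emph{strategically Ramsey} if for every $p\in P$ there is $q\leqslant p$ such that either I has a strategy to reach $\mathcal{X}^c$ in $F_q$, or II has a strategy to reach $\mathcal{X}$ in $G_q$. *)

theory Defs
  imports "HOL-Analysis.Analysis"
begin

abbreviation Seq :: "'x set \<Rightarrow> 'x list set"
  where "Seq X \<equiv> lists X - {[]}"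

locale gowers_space =
  fixes P :: "'p set"
    and X :: "'x set"
    and le :: "'p rel"
    and les :: "'p rel"
    and tri :: "('x list \<times> 'p) set"
  assumes P_nonempty: "P \<noteq> {}"
    and X_nonempty: "X \<noteq> {}"
    and X_countable: "countable X"
    and le_quasiorder: "preorder_on P le"
    and les_quasiorder: "preorder_on P les"
    and tri_subset: "tri \<subseteq> Seq X \<times> P"
    and le_imp_les: "\<lbrakk>p \<in> P; q \<in> P; (p, q) \<in> le\<rbrakk> \<Longrightarrow> (p, q) \<in> les"
    and les_refine: "\<lbrakk>p \<in> P; q \<in> P; (p, q) \<in> les\<rbrakk>
        \<Longrightarrow> \<exists>r\<in>P. (r, p) \<in> le \<and> (r, q) \<in> le \<and> (p, r) \<in> les"
    and diagonal: "\<lbrakk>\<And>i. p' i \<in> P; \<And>i. (p' (Suc i), p' i) \<in> le\<rbrakk>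
        \<Longrightarrow> \<exists>q\<in>P. \<forall>i::nat. (q, p' i) \<in> les"
    and extend: "\<lbrakk>p \<in> P; s \<in> lists X\<rbrakk> \<Longrightarrow> \<exists>x\<in>X. (s @ [x], p) \<in> tri"
    and tri_mono: "\<lbrakk>s \<in> Seq X; p \<in> P; q \<in> P; (s, p) \<in> tri; (p, q) \<in> le\<rbrakk>
        \<Longrightarrow> (s, q) \<in> tri"
begin

definition lessapprox :: "'p \<Rightarrow> 'p \<Rightarrow> bool"
  where "lessapprox p q \<longleftrightarrow> (p, q) \<in> le \<and> (q, p) \<in> les"

text \<open>
  A run of a game consists of the sequence \<open>p\<close> of moves of I and the sequence \<open>x\<close> of moves of II;
  in round \<open>i\<close>, I plays \<open>p i\<close> and then II plays \<open>x i\<close>. Gowers' game and the asymptotic game differ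
  only in the set \<open>M\<close> of moves permitted to I.
\<close>

definition gowers_moves :: "'p \<Rightarrow> 'p set"
  where "gowers_moves q = {r \<in> P. (r, q) \<in> le}"

definition asymptotic_moves :: "'p \<Rightarrow> 'p set"
  where "asymptotic_moves q = {r \<in> P. lessapprox r q}"

definition I_obeys :: "'p set \<Rightarrow> (nat \<Rightarrow> 'p) \<Rightarrow> nat \<Rightarrow> bool"
  where "I_obeys M p i \<longleftrightarrow> p i \<in> M"

definition II_obeys :: "(nat \<Rightarrow> 'p) \<Rightarrow> (nat \<Rightarrow> 'x) \<Rightarrow> nat \<Rightarrow> bool"
  where "II_obeys p x i \<longleftrightarrow> x i \<in> X \<and> (map x [0..<Suc i], p i) \<in> tri"

text \<open>
  The player who first breaks a rule loses. If both players obey their rules throughout, the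
  outcome \<open>x\<close> decides: each of the following is the winning condition of a player who wants to
  reach \<open>Y\<close>.
\<close>

definition won_by_I :: "'p set \<Rightarrow> (nat \<Rightarrow> 'x) set \<Rightarrow> (nat \<Rightarrow> 'p) \<Rightarrow> (nat \<Rightarrow> 'x) \<Rightarrow> bool"
  where "won_by_I M Y p x \<longleftrightarrow>
    (\<exists>i. \<not> II_obeys p x i \<and> (\<forall>j\<le>i. I_obeys M p j)) \<or>
    ((\<forall>i. I_obeys M p i \<and> II_obeys p x i) \<and> x \<in> Y)"

definition won_by_II :: "'p set \<Rightarrow> (nat \<Rightarrow> 'x) set \<Rightarrow> (nat \<Rightarrow> 'p) \<Rightarrow> (nat \<Rightarrow> 'x) \<Rightarrow> bool"
  where "won_by_II M Y p x \<longleftrightarrow>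
    (\<exists>i. \<not> I_obeys M p i \<and> (\<forall>j<i. II_obeys p x j)) \<or>
    ((\<forall>i. I_obeys M p i \<and> II_obeys p x i) \<and> x \<in> Y)"

text \<open>
  A strategy maps the list of the opponent's previous moves to the next move. The player's own
  previous moves need not be an argument, as the strategy determines them.
\<close>

definition I_can_reach :: "'p set \<Rightarrow> (nat \<Rightarrow> 'x) set \<Rightarrow> bool"
  where "I_can_reach M Y \<longleftrightarrow>
    (\<exists>\<sigma> :: 'x list \<Rightarrow> 'p. \<forall>p x. (\<forall>i. p i = \<sigma> (map x [0..<i])) \<longrightarrow> won_by_I M Y p x)"

definition II_can_reach :: "'p set \<Rightarrow> (nat \<Rightarrow> 'x) set \<Rightarrow> bool"
  where "II_can_reach M Y \<longleftrightarrow>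
    (\<exists>\<tau> :: 'p list \<Rightarrow> 'x. \<forall>p x. (\<forall>i. x i = \<tau> (map p [0..<Suc i])) \<longrightarrow> won_by_II M Y p x)"

definition strategically_Ramsey :: "(nat \<Rightarrow> 'x) set \<Rightarrow> bool"
  where "strategically_Ramsey A \<longleftrightarrow>
    (\<forall>p\<in>P. \<exists>q\<in>P. (q, p) \<in> le \<and>
      (I_can_reach (asymptotic_moves q) ((UNIV \<rightarrow> X) - A) \<or>
       II_can_reach (gowers_moves q) A))"

end

definition seq_topology :: "'x set \<Rightarrow> (nat \<Rightarrow> 'x) topology"
  where "seq_topology X = product_topology (\<lambda>_. discrete_topology X) UNIV"

text \<open>
  Analytic subsets of a Polish space: the empty set and the continuous images of the Baire space.
\<close>

definition analytic_in :: "'a topology \<Rightarrow> 'a set \<Rightarrow> bool"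
  where "analytic_in T A \<longleftrightarrow>
    A = {} \<or>
    (\<exists>f. continuous_map (seq_topology (UNIV :: nat set)) T f \<and>
         A = f ` topspace (seq_topology (UNIV :: nat set)))"

end

theory Submission
  imports Defs
begin

text \<open>
  Let \<open>A = range f\<close> with \<open>f\<close> continuous on the Baire space. The proof unfolds \<open>A\<close>: while II plays
  \<open>x\<close>, she also builds, digit by digit, some \<open>\<alpha>\<close> with \<open>f \<alpha> = x\<close>. A position of this unfolded game is a
  pair \<open>(t, s)\<close> of the digits and the moves of II so far, and only countably many positions exist. II
  may play arbitrarily many moves before she announces the next digit, and so her goal, to announce
  infinitely many digits, is a \<open>G\<^sub>\<delta>\<close> condition. The positions in which she fails therefore form a
  least fixed point \<open>hopeless C q\<close>, where \<open>C t s\<close> says that some \<open>\<alpha>\<close> extends \<open>t\<close> while \<open>f \<alpha>\<close>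
  extends \<open>s\<close>: the position \<open>(t, s)\<close> is hopeless if, in no Gowers game below \<open>q\<close>, II can force the
  play from \<open>s\<close> to a point at which some further digit leads to a position that is consistent
  with \<open>C\<close> and not hopeless.

  All notions involved pass from \<open>q\<close> to every \<open>q' \<le>\<^sup>* q\<close>, because by \<open>les_refine\<close> a move below
  \<open>q'\<close> can be refined to one below both. The axiom \<open>diagonal\<close> then makes countably many of them final at a
  single \<open>q\<close> (lemma \<open>fusion_countable_set\<close>): no \<open>r \<le> q\<close> changes them. At such a \<open>q\<close>, for an open
  target, II reaches it in \<open>G\<^sub>q\<close> or I avoids it in \<open>F\<^sub>q\<close> (lemma \<open>reach_or_avoid\<close>).

  If the initial position is not hopeless, II moves from one position that is not hopeless to the next,
  adding a digit each time; continuity of \<open>f\<close> yields \<open>f \<alpha> = x\<close> for the resulting \<open>\<alpha>\<close>. If it is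
  hopeless, then hopeless positions have ranks (lemma \<open>lfp_ranking\<close>), and at a hopeless \<open>(t, s)\<close> player I
  can prevent II from ever announcing a digit that is consistent with \<open>C\<close> and leads to a position
  not of smaller rank. He does not see the digits, so he must do this for all \<open>t\<close> at once. Since moves
  \<open>r \<lessapprox> q\<close> have common refinements only in finite number, he attends in round \<open>m\<close> only to finitely
  many \<open>t\<close>, those of length and digits bounded in terms of \<open>m\<close>. This suffices because II, too, may wait: if
  the outcome were \<open>f \<alpha>\<close>, every initial segment of \<open>\<alpha>\<close> would receive attention from some round
  on, and the ranks of the corresponding positions would decrease forever.
\<close>

section \<open>Least fixed points come with ranks\<close>

text \<open>
  The set \<open>B u\<close> consists of the elements that enter the fixed point at a stage before \<open>u\<close> does. The stages
  are indexed by a well-ordering of \<open>'a set\<close>: a strictly growing sequence of that length would inject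
  \<open>'a set\<close> into \<open>'a\<close>, so by Cantor's theorem the iteration has reached the fixed point by then.
\<close>

lemma lfp_ranking:
  fixes F :: "'a set \<Rightarrow> 'a set"
  assumes "mono F"
  obtains B where "wf {(v, u). v \<in> B u}" "\<And>u. u \<in> lfp F \<Longrightarrow> u \<in> F (B u)" "\<And>u. B u \<subseteq> lfp F"
proof -
  obtain W :: "'a set rel" where W: "well_order_on UNIV W"
    using well_order_on by blast
  define R where "R = W - Id"
  have wf: "wf R"
    using W by (simp add: well_order_on_def R_def)
  have trans: "trans R"
    using W unfolding R_def well_order_on_def linear_order_on_def partial_order_on_def preorder_on_def
    by (blast intro: trans_diff_Id)
  have total: "v = w \<or> (v, w) \<in> R \<or> (w, v) \<in> R" for v w
    using W unfolding R_def well_order_on_def linear_order_on_def total_on_def by auto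
  define stage where "stage = wfrec R (\<lambda>g w. F (\<Union>v\<in>{v. (v, w) \<in> R}. g v))"
  define below where "below w = (\<Union>v\<in>{v. (v, w) \<in> R}. stage v)" for w
  have stage: "stage w = F (below w)" for w
    unfolding stage_def below_def
    by (subst wfrec[OF wf]) (simp add: cut_apply)
  have stage_sub: "stage w \<subseteq> lfp F" for w
  proof (induction w rule: wf_induct_rule[OF wf])
    case (1 w)
    then have "below w \<subseteq> lfp F"
      unfolding below_def by blast
    then have "F (below w) \<subseteq> F (lfp F)"
      by (rule monoD[OF assms])
    then show ?case
      using stage lfp_unfold[OF assms] by auto
  qed
  have "\<exists>w. F (below w) \<subseteq> below w"
  proof (rule ccontr)
    assume "\<nexists>w. F (below w) \<subseteq> below w"
    then have "\<forall>w. \<exists>u. u \<in> stage w \<and> u \<notin> below w"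
      unfolding stage by blast
    then obtain g where g: "\<And>w. g w \<in> stage w" "\<And>w. g w \<notin> below w"
      by metis
    have "inj g"
    proof (rule injI)
      fix v w
      assume "g v = g w"
      then show "v = w"
        using total[of v w] g[of v] g[of w] unfolding below_def by auto
    qed
    then have "range (inv g) = Pow (UNIV :: 'a set)"
      by (simp add: inj_imp_surj_inv)
    then show False
      using Cantors_theorem by blast
  qed
  then obtain top_stage where "lfp F \<subseteq> below top_stage"
    using lfp_lowerbound by blast
  then have "\<exists>w. u \<in> stage w" if "u \<in> lfp F" for u
    using that unfolding below_def by blast
  then have "\<exists>w. u \<in> stage w \<and> (\<forall>v. (v, w) \<in> R \<longrightarrow> u \<notin> stage v)" if "u \<in> lfp F" for u
    using wfE_min[OF wf, of _ "{w. u \<in> stage w}"] that by (metis mem_Collect_eq)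
  then obtain rk where rk: "\<And>u. u \<in> lfp F \<Longrightarrow> u \<in> stage (rk u)"
    and rk_min: "\<And>u v. u \<in> lfp F \<Longrightarrow> (v, rk u) \<in> R \<Longrightarrow> u \<notin> stage v"
    by metis
  define B where "B u = (if u \<in> lfp F then below (rk u) else {})" for u
  have "(rk v, rk u) \<in> R" if v: "v \<in> B u" for u v
  proof -
    have "u \<in> lfp F"
      using v by (auto simp: B_def split: if_splits)
    then obtain w where w: "(w, rk u) \<in> R" "v \<in> stage w"
      using v \<open>u \<in> lfp F\<close> unfolding B_def below_def by auto
    then have "v \<in> lfp F"
      using stage_sub by blast
    then have "rk v = w \<or> (rk v, w) \<in> R"
      using total[of "rk v" w] rk_min w(2) by blast
    then show ?thesis
      using w(1) trans by (auto dest: transD)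
  qed
  then have "{(v, u). v \<in> B u} \<subseteq> inv_image R rk"
    by auto
  then have "wf {(v, u). v \<in> B u}"
    using wf_inv_image[OF wf] wf_subset by blast
  moreover have "u \<in> F (B u)" if "u \<in> lfp F" for u
    using rk[OF that] that by (simp add: B_def stage)
  moreover have "B u \<subseteq> lfp F" for u
    unfolding B_def below_def using stage_sub by auto
  ultimately show ?thesis
    using that by blast
qed

section \<open>Fusion\<close>

context gowers_space
begin

lemma le_refl: "p \<in> P \<Longrightarrow> (p, p) \<in> le"
  using le_quasiorder by (auto simp: preorder_on_def refl_on_def)

lemma les_refl: "p \<in> P \<Longrightarrow> (p, p) \<in> les"
  using les_quasiorder by (auto simp: preorder_on_def refl_on_def)

lemma le_trans: "(p, q) \<in> le \<Longrightarrow> (q, r) \<in> le \<Longrightarrow> (p, r) \<in> le"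
  using le_quasiorder by (auto simp: preorder_on_def dest: transD)

lemma les_trans: "(p, q) \<in> les \<Longrightarrow> (q, r) \<in> les \<Longrightarrow> (p, r) \<in> les"
  using les_quasiorder by (auto simp: preorder_on_def dest: transD)

text \<open>
  Properties are treated one at a time: the \<open>k\<close>-th step of a decreasing sequence passes to some
  element that satisfies the \<open>k\<close>-th property, if there is one. A lower bound for \<open>\<le>\<^sup>*\<close> of the sequence inherits
  everything gained on the way, and whatever it has not gained is out of reach below it.
\<close>

lemma fusion_countable_set:
  fixes \<phi> :: "'i \<Rightarrow> 'p \<Rightarrow> bool"
  assumes "countable S" and p: "p \<in> P"
    and hered: "\<And>i q r. \<lbrakk>i \<in> S; q \<in> P; r \<in> P; (r, q) \<in> les; \<phi> i q\<rbrakk> \<Longrightarrow> \<phi> i r"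
  shows "\<exists>q\<in>P. (q, p) \<in> le \<and> (\<forall>i\<in>S. \<forall>r\<in>P. (r, q) \<in> le \<longrightarrow> \<phi> i r \<longrightarrow> \<phi> i q)"
proof (cases "S = {}")
  case True
  then show ?thesis
    using p le_refl by blast
next
  case False
  define e where "e = from_nat_into S"
  have e: "e k \<in> S" for k
    using False by (simp add: e_def from_nat_into)
  have refine: "\<exists>q'\<in>P. (q', q) \<in> le \<and> ((\<exists>r\<in>P. (r, q) \<in> le \<and> \<phi> (e k) r) \<longrightarrow> \<phi> (e k) q')"
    if "q \<in> P" for q k
    using that le_refl by blast
  have "\<exists>a. \<forall>k. (a k \<in> P \<and> (k = 0 \<longrightarrow> a k = p)) \<and> ((a (Suc k), a k) \<in> le \<and>
      ((\<exists>r\<in>P. (r, a k) \<in> le \<and> \<phi> (e k) r) \<longrightarrow> \<phi> (e k) (a (Suc k))))"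
  proof (rule dependent_nat_choice)
    show "\<exists>q. q \<in> P \<and> (0 = (0 :: nat) \<longrightarrow> q = p)"
      using p by blast
    show "\<exists>q'. (q' \<in> P \<and> (Suc k = 0 \<longrightarrow> q' = p)) \<and> ((q', q) \<in> le \<and>
        ((\<exists>r\<in>P. (r, q) \<in> le \<and> \<phi> (e k) r) \<longrightarrow> \<phi> (e k) q'))"
      if "q \<in> P \<and> (k = 0 \<longrightarrow> q = p)" for q k
      using refine[of q k] that by (metis nat.distinct(1))
  qed
  then obtain a where aP: "\<And>k. a k \<in> P" and a0: "a 0 = p"
    and a_le: "\<And>k. (a (Suc k), a k) \<in> le"
    and a: "\<And>k r. \<lbrakk>r \<in> P; (r, a k) \<in> le; \<phi> (e k) r\<rbrakk> \<Longrightarrow> \<phi> (e k) (a (Suc k))"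
    by blast
  obtain d where d: "d \<in> P" "\<And>k. (d, a k) \<in> les"
    using diagonal[of a] aP a_le by blast
  then obtain q where q: "q \<in> P" "(q, d) \<in> le" "(q, p) \<in> le"
    using les_refine[of d p] p a0 by metis
  have q_les: "(q, a k) \<in> les" for k
    using q d le_imp_les les_trans by blast
  have "\<phi> i q" if i: "i \<in> S" "\<phi> i r" and r: "r \<in> P" "(r, q) \<in> le" for i r
  proof -
    obtain k where k: "i = e k"
      using from_nat_into_surj[OF \<open>countable S\<close> \<open>i \<in> S\<close>] unfolding e_def by metis
    have "(r, a k) \<in> les"
      using r q q_les le_imp_les les_trans by blast
    then obtain r' where r': "r' \<in> P" "(r', r) \<in> le" "(r', a k) \<in> le"
      using les_refine r(1) aP by meson
    then have "\<phi> i r'"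
      using hered[OF i(1) r(1)] i(2) r(1) le_imp_les by blast
    then have "\<phi> i (a (Suc k))"
      using a[of r' k] r' k by blast
    then show ?thesis
      using hered[OF i(1) aP q(1) q_les] by blast
  qed
  then show ?thesis
    using q by blast
qed

text \<open>
  Any two \<open>r, r' \<lessapprox> q\<close> satisfy \<open>r \<le>\<^sup>* r'\<close>, as \<open>r \<le> q \<le>\<^sup>* r'\<close>, so \<open>les_refine\<close> refines them to
  one move. This gives finite families only; a countable family need not have a common
  refinement.
\<close>

lemma common_lessapprox:
  assumes "finite W" and q: "q \<in> P"
    and ex: "\<And>w. w \<in> W \<Longrightarrow> \<exists>r\<in>P. lessapprox r q \<and> \<psi> w r"
    and down: "\<And>w r r'. \<lbrakk>w \<in> W; r \<in> P; r' \<in> P; (r', r) \<in> le; \<psi> w r\<rbrakk> \<Longrightarrow> \<psi> w r'"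
  shows "\<exists>r\<in>P. lessapprox r q \<and> (\<forall>w\<in>W. \<psi> w r)"
  using assms(1) ex down
proof (induction W rule: finite_induct)
  case empty
  then show ?case
    using q le_refl les_refl by (auto simp: lessapprox_def)
next
  case (insert w W)
  obtain r where r: "r \<in> P" "lessapprox r q" "\<forall>w\<in>W. \<psi> w r"
    using insert by (metis insertCI)
  obtain r' where r': "r' \<in> P" "lessapprox r' q" "\<psi> w r'"
    using insert by blast
  have "(r, r') \<in> les"
    using r r' le_imp_les les_trans q unfolding lessapprox_def by blast
  then obtain z where z: "z \<in> P" "(z, r) \<in> le" "(z, r') \<in> le" "(r, z) \<in> les"
    using les_refine r r' by meson
  then have "lessapprox z q"
    using r le_trans les_trans unfolding lessapprox_def by blast
  moreover have "\<psi> v z" if "v \<in> insert w W" for v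
    using that z r r' insert.prems(2) by (metis insertE insertI1 insertI2)
  ultimately show ?case
    using z by blast
qed

section \<open>Open targets\<close>

text \<open>
  \<open>reach q V\<close> is the set of positions from which II can force the play of Gowers' game below \<open>q\<close> into
  \<open>V\<close>. At least one further move is required, which makes II add at most one digit per round in the
  unfolded game.
\<close>

definition reach_step :: "'p \<Rightarrow> 'x list set \<Rightarrow> 'x list set \<Rightarrow> 'x list set"
  where "reach_step q V Z = {s \<in> lists X. \<forall>r\<in>P. (r, q) \<in> le \<longrightarrow>
    (\<exists>x\<in>X. (s @ [x], r) \<in> tri \<and> s @ [x] \<in> V \<union> Z)}"

definition reach :: "'p \<Rightarrow> 'x list set \<Rightarrow> 'x list set"
  where "reach q V = lfp (reach_step q V)"

lemma mono_reach_step: "mono (reach_step q V)"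
  unfolding mono_def reach_step_def by blast

lemma reach_unfold: "reach q V = reach_step q V (reach q V)"
  unfolding reach_def by (rule lfp_unfold[OF mono_reach_step])

lemma reach_mono: "V \<subseteq> V' \<Longrightarrow> reach q V \<subseteq> reach q V'"
  unfolding reach_def by (rule lfp_mono) (unfold reach_step_def, blast)

text \<open>
  II answers a move \<open>r \<le> q'\<close> as she would answer an \<open>r' \<le> r\<close> with \<open>r' \<le> q\<close>; the answer remains legal
  for the larger \<open>r\<close>.
\<close>

lemma reach_antimono_les:
  assumes "q \<in> P" "q' \<in> P" "(q', q) \<in> les"
  shows "reach q V \<subseteq> reach q' V"
  unfolding reach_def
proof (rule lfp_mono, rule subsetI)
  fix Z s
  assume s: "s \<in> reach_step q V Z"
  have "\<exists>x\<in>X. (s @ [x], r) \<in> tri \<and> s @ [x] \<in> V \<union> Z" if r: "r \<in> P" "(r, q') \<in> le" for r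
  proof -
    have "(r, q) \<in> les"
      using r assms le_imp_les les_trans by blast
    then obtain r' where r': "r' \<in> P" "(r', r) \<in> le" "(r', q) \<in> le"
      using les_refine r assms by meson
    then obtain x where x: "x \<in> X" "(s @ [x], r') \<in> tri" "s @ [x] \<in> V \<union> Z"
      using s unfolding reach_step_def by blast
    then have "s @ [x] \<in> Seq X"
      using s by (auto simp: reach_step_def)
    then show ?thesis
      using tri_mono x r' r by meson
  qed
  then show "s \<in> reach_step q' V Z"
    using s by (auto simp: reach_step_def)
qed

lemma reach_le:
  assumes "q \<in> P" "q' \<in> P" "(q', q) \<in> le"
  shows "reach q V \<subseteq> reach q' V"
  using reach_antimono_les le_imp_les assms by meson

text \<open>
  Two fusions are needed. The first makes the sets \<open>reach q V\<close> final. A position outside \<open>reach q V\<close> then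
  has a move \<open>r \<le> q\<close> of I after which II stays outside; but in the asymptotic game I must play
  \<open>r \<lessapprox> q\<close>. The second fusion closes this gap, as having such a move \<open>r\<close> with \<open>q \<le>\<^sup>* r\<close> is a property
  that is inherited along \<open>\<le>\<^sup>*\<close> and is satisfied by \<open>r\<close> itself.
\<close>

lemma reach_or_avoid:
  assumes "countable \<V>" and p: "p \<in> P"
  obtains q where "q \<in> P" "(q, p) \<in> le"
    "\<And>V s r. \<lbrakk>V \<in> \<V>; s \<in> lists X; r \<in> P; (r, q) \<in> le; s \<in> reach r V\<rbrakk> \<Longrightarrow> s \<in> reach q V"
    "\<And>V s. \<lbrakk>V \<in> \<V>; s \<in> lists X; s \<notin> reach q V\<rbrakk> \<Longrightarrow> \<exists>r\<in>P. lessapprox r q \<and>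
      (\<forall>x\<in>X. (s @ [x], r) \<in> tri \<longrightarrow> s @ [x] \<notin> V \<and> s @ [x] \<notin> reach q V)"
proof -
  let ?S = "\<V> \<times> lists X"
  have S: "countable ?S"
    using assms(1) X_countable by blast
  have "\<exists>q\<in>P. (q, p) \<in> le \<and> (\<forall>i\<in>?S. \<forall>r\<in>P. (r, q) \<in> le \<longrightarrow>
      snd i \<in> reach r (fst i) \<longrightarrow> snd i \<in> reach q (fst i))"
    by (rule fusion_countable_set[OF S p]) (use reach_antimono_les in blast)
  then obtain a where a: "a \<in> P" "(a, p) \<in> le"
    and a_stable: "\<And>V s r. \<lbrakk>V \<in> \<V>; s \<in> lists X; r \<in> P; (r, a) \<in> le; s \<in> reach r V\<rbrakk> \<Longrightarrow> s \<in> reach a V"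
    by fastforce
  define can_avoid where "can_avoid i q \<longleftrightarrow> (\<exists>r\<in>P. (q, r) \<in> les \<and>
      (\<forall>x\<in>X. (snd i @ [x], r) \<in> tri \<longrightarrow> snd i @ [x] \<notin> fst i \<and> snd i @ [x] \<notin> reach a (fst i)))"
    for i :: "'x list set \<times> 'x list" and q
  have "\<exists>q\<in>P. (q, a) \<in> le \<and> (\<forall>i\<in>?S. \<forall>r\<in>P. (r, q) \<in> le \<longrightarrow> can_avoid i r \<longrightarrow> can_avoid i q)"
    by (rule fusion_countable_set[OF S a(1)]) (use les_trans in \<open>unfold can_avoid_def, blast\<close>)
  then obtain q where q: "q \<in> P" "(q, a) \<in> le"
    and q_stable: "\<And>i r. \<lbrakk>i \<in> ?S; r \<in> P; (r, q) \<in> le; can_avoid i r\<rbrakk> \<Longrightarrow> can_avoid i q"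
    by blast
  have same: "s \<in> reach r V \<longleftrightarrow> s \<in> reach a V"
    if "V \<in> \<V>" "s \<in> lists X" "r \<in> P" "(r, q) \<in> le" for V s r
    using a_stable reach_le le_trans q a that by (meson subsetD)
  have "\<exists>r\<in>P. lessapprox r q \<and>
      (\<forall>x\<in>X. (s @ [x], r) \<in> tri \<longrightarrow> s @ [x] \<notin> V \<and> s @ [x] \<notin> reach q V)"
    if V: "V \<in> \<V>" and s: "s \<in> lists X" and no: "s \<notin> reach q V" for V s
  proof -
    have "s \<notin> reach_step q V (reach q V)"
      using no reach_unfold by blast
    then obtain r where r: "r \<in> P" "(r, q) \<in> le"
      "\<forall>x\<in>X. (s @ [x], r) \<in> tri \<longrightarrow> s @ [x] \<notin> V \<and> s @ [x] \<notin> reach q V"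
      using s unfolding reach_step_def by blast
    have "can_avoid (V, s) r"
      unfolding can_avoid_def using r les_refl[OF r(1)] same[OF V _ q(1) le_refl] s q
      by (intro bexI[of _ r]) auto
    then have "can_avoid (V, s) q"
      using q_stable V s r by blast
    then obtain r' where r': "r' \<in> P" "(q, r') \<in> les"
      "\<forall>x\<in>X. (s @ [x], r') \<in> tri \<longrightarrow> s @ [x] \<notin> V \<and> s @ [x] \<notin> reach a V"
      unfolding can_avoid_def by auto
    then obtain z where z: "z \<in> P" "(z, q) \<in> le" "(z, r') \<in> le" "(q, z) \<in> les"
      using les_refine q by meson
    have "s @ [x] \<notin> V \<and> s @ [x] \<notin> reach q V" if "x \<in> X" "(s @ [x], z) \<in> tri" for x
    proof -
      have "s @ [x] \<in> Seq X"
        using s that by auto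
      then have "(s @ [x], r') \<in> tri"
        using tri_mono that z r' by meson
      then show ?thesis
        using r' that same[OF V _ q(1) le_refl] q s by auto
    qed
    then show ?thesis
      using z unfolding lessapprox_def by blast
  qed
  moreover have "(q, p) \<in> le"
    using q a le_trans by blast
  moreover have "s \<in> reach q V"
    if "V \<in> \<V>" "s \<in> lists X" "r \<in> P" "(r, q) \<in> le" "s \<in> reach r V" for V s r
    using same[OF that(1,2)] that q le_refl by blast
  ultimately show thesis
    by - (rule that[OF q(1)])
qed

section \<open>The unfolded game\<close>

text \<open>
  II promises the next digit \<open>n\<close> at a moment when it is consistent with \<open>C\<close> and leads out of \<open>Z\<close>.
\<close>

definition promise_targets ::
    "(nat list \<Rightarrow> 'x list \<Rightarrow> bool) \<Rightarrow> (nat list \<times> 'x list) set \<Rightarrow> nat list \<Rightarrow> 'x list set"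
  where "promise_targets C Z t = {s. \<exists>n. C (t @ [n]) s \<and> (t @ [n], s) \<notin> Z}"

text \<open>
  The quantification over all \<open>r \<le> q\<close> makes hopelessness inherited along \<open>\<le>\<^sup>*\<close>.
\<close>

definition hopeless_step ::
    "(nat list \<Rightarrow> 'x list \<Rightarrow> bool) \<Rightarrow> 'p \<Rightarrow> (nat list \<times> 'x list) set \<Rightarrow> (nat list \<times> 'x list) set"
  where "hopeless_step C q Z =
    {(t, s). \<forall>r\<in>P. (r, q) \<in> le \<longrightarrow> s \<notin> reach r (promise_targets C Z t)}"

definition hopeless :: "(nat list \<Rightarrow> 'x list \<Rightarrow> bool) \<Rightarrow> 'p \<Rightarrow> (nat list \<times> 'x list) set"
  where "hopeless C q = lfp (hopeless_step C q)"

lemma mono_hopeless_step: "mono (hopeless_step C q)"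
proof (rule monoI)
  fix Y Z :: "(nat list \<times> 'x list) set"
  assume "Y \<subseteq> Z"
  then have "promise_targets C Z t \<subseteq> promise_targets C Y t" for t
    unfolding promise_targets_def by blast
  then have "reach r (promise_targets C Z t) \<subseteq> reach r (promise_targets C Y t)" for r t
    by (rule reach_mono)
  then show "hopeless_step C q Y \<subseteq> hopeless_step C q Z"
    unfolding hopeless_step_def by blast
qed

lemma hopeless_unfold: "hopeless C q = hopeless_step C q (hopeless C q)"
  unfolding hopeless_def by (rule lfp_unfold[OF mono_hopeless_step])

lemma hopeless_mono_les:
  assumes "q \<in> P" "q' \<in> P" "(q', q) \<in> les"
  shows "hopeless C q \<subseteq> hopeless C q'"
  unfolding hopeless_def
proof (rule lfp_mono, clarify)
  fix Z t s
  assume ts: "(t, s) \<in> hopeless_step C q Z"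
  have "s \<notin> reach r (promise_targets C Z t)" if r: "r \<in> P" "(r, q') \<in> le" for r
  proof -
    have "(r, q) \<in> les"
      using r assms le_imp_les les_trans by blast
    then obtain r' where r': "r' \<in> P" "(r', r) \<in> le" "(r', q) \<in> le"
      using les_refine r assms by meson
    then show ?thesis
      using ts reach_le[OF r(1) r'(1,2)] unfolding hopeless_step_def by blast
  qed
  then show "(t, s) \<in> hopeless_step C q' Z"
    unfolding hopeless_step_def by blast
qed

lemma hopeless_decided:
  assumes p: "p \<in> P"
  obtains q where "q \<in> P" "(q, p) \<in> le"
    "\<And>r. r \<in> P \<Longrightarrow> (r, q) \<in> le \<Longrightarrow> hopeless C r = hopeless C q"
proof -
  let ?S = "UNIV \<times> lists X :: (nat list \<times> 'x list) set"
  have S: "countable ?S"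
    using X_countable by blast
  have "\<exists>q\<in>P. (q, p) \<in> le \<and> (\<forall>i\<in>?S. \<forall>r\<in>P. (r, q) \<in> le \<longrightarrow>
      i \<in> hopeless C r \<longrightarrow> i \<in> hopeless C q)"
    by (rule fusion_countable_set[OF S p]) (use hopeless_mono_les in blast)
  then obtain q where q: "q \<in> P" "(q, p) \<in> le"
    and stable: "\<And>i r. \<lbrakk>i \<in> ?S; r \<in> P; (r, q) \<in> le; i \<in> hopeless C r\<rbrakk> \<Longrightarrow> i \<in> hopeless C q"
    by blast
  have outside: "(t, s) \<in> hopeless C q" if "s \<notin> lists X" for t s
  proof -
    have "s \<notin> reach r V" for r V
      using that reach_unfold[of r V] by (auto simp: reach_step_def)
    then show ?thesis
      by (subst hopeless_unfold) (auto simp: hopeless_step_def)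
  qed
  have "hopeless C r = hopeless C q" if "r \<in> P" "(r, q) \<in> le" for r
  proof
    show "hopeless C r \<subseteq> hopeless C q"
    proof clarify
      fix t s
      assume "(t, s) \<in> hopeless C r"
      then show "(t, s) \<in> hopeless C q"
        using stable[OF _ that, of "(t, s)"] outside[of s t] by (cases "s \<in> lists X") auto
    qed
    show "hopeless C q \<subseteq> hopeless C r"
      using hopeless_mono_les that q le_imp_les by meson
  qed
  then show ?thesis
    using that q by blast
qed

text \<open>
  For each \<open>u = (t, s)\<close> the open set to be avoided depends on \<open>B u\<close>, that is, on the rank at the moment
  \<open>s\<close> when \<open>t\<close> came to attention. Hence \<open>u\<close> and not just \<open>t\<close> is kept in mind for the rest of
  the play. Should \<open>x \<in> A\<close> hold with witness \<open>\<alpha>\<close>, then along pairs of initial segments of \<open>\<alpha>\<close> and \<open>x\<close> one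
  could descend forever in the well-founded relation given by \<open>B\<close>.
\<close>

lemma I_can_reach_by_avoiding:
  assumes q: "q \<in> P"
    and wf: "wf {(v, u). v \<in> B u}"
    and B: "\<And>t s. (t, s) \<in> L \<Longrightarrow> s \<notin> reach q (promise_targets C (B (t, s)) t)"
    and BL: "\<And>u. B u \<subseteq> L"
    and avoid: "\<And>u s. \<lbrakk>snd u \<in> lists X; s \<in> lists X; s \<notin> reach q (promise_targets C (B u) (fst u))\<rbrakk> \<Longrightarrow>
      \<exists>r\<in>P. lessapprox r q \<and> (\<forall>x\<in>X. (s @ [x], r) \<in> tri \<longrightarrow>
        s @ [x] \<notin> promise_targets C (B u) (fst u) \<and>
        s @ [x] \<notin> reach q (promise_targets C (B u) (fst u)))"
    and init: "([], []) \<in> L"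
    and C: "\<And>x. x \<in> A \<Longrightarrow> \<exists>\<alpha>. \<forall>k m. C (map \<alpha> [0..<k]) (map x [0..<m])"
  shows "I_can_reach (asymptotic_moves q) ((UNIV \<rightarrow> X) - A)"
proof -
  let ?V = "\<lambda>u. promise_targets C (B u) (fst u)"
  \<comment> \<open>After the moves \<open>s\<close>, player I attends to these pairs: finitely many, as the length of \<open>s'\<close>
      bounds \<open>t\<close>, yet every \<open>t\<close> occurs with all sufficiently long initial segments of the play.\<close>
  define active where "active s = {(t, s'). set t \<subseteq> {..<length s'} \<and> length t \<le> length s' \<and>
      (\<exists>m\<le>length s. s' = take m s)}" for s :: "'x list"
  have finite_active: "finite (active s)" for s
  proof -
    have "active s \<subseteq> {t. set t \<subseteq> {..<length s} \<and> length t \<le> length s} \<times> (\<lambda>m. take m s) ` {..length s}"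
      unfolding active_def by auto
    then show ?thesis
      by (rule finite_subset) (simp add: finite_lists_length_le)
  qed
  define keeps where "keeps s u r \<longleftrightarrow> (\<forall>x\<in>X. (s @ [x], r) \<in> tri \<longrightarrow>
      s @ [x] \<notin> ?V u \<and> s @ [x] \<notin> reach q (?V u))" for s u r
  have "\<exists>r\<in>P. lessapprox r q \<and> (\<forall>u\<in>{u \<in> active s. s \<notin> reach q (?V u)}. keeps s u r)"
    if s: "s \<in> lists X" for s
  proof (rule common_lessapprox[OF _ q])
    show "finite {u \<in> active s. s \<notin> reach q (?V u)}"
      using finite_active by simp
    show "\<exists>r\<in>P. lessapprox r q \<and> keeps s u r" if "u \<in> {u \<in> active s. s \<notin> reach q (?V u)}" for u
    proof -
      have "snd u \<in> lists X"
        using that s unfolding active_def by (auto dest!: in_set_takeD)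
      then show ?thesis
        using avoid[OF _ s] that unfolding keeps_def by blast
    qed
    fix u r r'
    assume r: "r \<in> P" "r' \<in> P" "(r', r) \<in> le" and keeps: "keeps s u r"
    have "(s @ [x], r) \<in> tri" if "x \<in> X" "(s @ [x], r') \<in> tri" for x
    proof -
      have "s @ [x] \<in> Seq X"
        using s that by auto
      then show ?thesis
        using tri_mono that r by meson
    qed
    then show "keeps s u r'"
      using keeps unfolding keeps_def by blast
  qed
  then have "\<forall>s. \<exists>r. r \<in> P \<and> lessapprox r q \<and>
      (s \<in> lists X \<longrightarrow> (\<forall>u\<in>active s. s \<notin> reach q (?V u) \<longrightarrow> keeps s u r))"
    using q le_refl les_refl unfolding lessapprox_def
    by (smt (verit, best) mem_Collect_eq)
  then obtain \<sigma> where \<sigma>P: "\<And>s. \<sigma> s \<in> P" "\<And>s. lessapprox (\<sigma> s) q"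
    and keeps: "\<And>s u. \<lbrakk>s \<in> lists X; u \<in> active s; s \<notin> reach q (?V u)\<rbrakk> \<Longrightarrow> keeps s u (\<sigma> s)"
    by metis
  have "won_by_I (asymptotic_moves q) ((UNIV \<rightarrow> X) - A) p x" if p: "\<forall>i. p i = \<sigma> (map x [0..<i])" for p x
  proof -
    have I: "I_obeys (asymptotic_moves q) p i" for i
      using \<sigma>P p unfolding I_obeys_def asymptotic_moves_def by auto
    have "x \<notin> A" if II: "\<forall>i. II_obeys p x i"
    proof
      assume "x \<in> A"
      then obtain \<alpha> where \<alpha>: "\<And>k m. C (map \<alpha> [0..<k]) (map x [0..<m])"
        using C by blast
      have x: "map x [0..<m] \<in> lists X" for m
        using II unfolding II_obeys_def by auto
      \<comment> \<open>This says that the first \<open>k\<close> digits of \<open>\<alpha>\<close> receive attention from round \<open>m\<close> on.\<close>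
      define fits where "fits k m \<longleftrightarrow> k \<le> m \<and> \<alpha> ` {..<k} \<subseteq> {..<m}" for k m
      have "\<not> fits k m" if "u = (map \<alpha> [0..<k], map x [0..<m])" "u \<in> L" for u k m
        using that
      proof (induction u arbitrary: k m rule: wf_induct_rule[OF wf])
        case (1 u)
        show ?case
        proof
          assume fits: "fits k m"
          have persist: "map x [0..<m + j] \<notin> reach q (?V u) \<and>
              (j > 0 \<longrightarrow> map x [0..<m + j] \<notin> ?V u)" for j
          proof (induction j)
            case 0
            then show ?case
              using B 1(2,3) by simp
          next
            case (Suc j)
            have "u \<in> active (map x [0..<m + j])"
              using fits 1(2) unfolding active_def fits_def
              by (auto simp: take_map atLeast0LessThan intro!: exI[of _ m])
            then have "keeps (map x [0..<m + j]) u (p (m + j))"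
              using keeps x Suc p by metis
            moreover have "x (m + j) \<in> X" "(map x [0..<Suc (m + j)], p (m + j)) \<in> tri"
              using II unfolding II_obeys_def by blast+
            ultimately show ?case
              unfolding keeps_def by auto
          qed
          obtain M where M: "\<alpha> ` {..<Suc k} \<subseteq> {..<M}"
            using finite_nat_iff_bounded[of "\<alpha> ` {..<Suc k}"] by auto
          \<comment> \<open>The next digit is admitted only after at least one more round, as
              \<open>persist\<close> excludes the target only for \<open>j > 0\<close>.\<close>
          define j where "j = Suc (k + M)"
          have "map x [0..<m + j] \<notin> ?V u"
            using persist[of j] unfolding j_def by blast
          moreover have "C (map \<alpha> [0..<k] @ [\<alpha> k]) (map x [0..<m + j])"
            using \<alpha>[of "Suc k" "m + j"] by simp
          ultimately have "(map \<alpha> [0..<Suc k], map x [0..<m + j]) \<in> B u"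
            unfolding promise_targets_def 1(2) by auto
          moreover from this have "(map \<alpha> [0..<Suc k], map x [0..<m + j]) \<in> L"
            using BL by blast
          moreover have "fits (Suc k) (m + j)"
            using M unfolding fits_def j_def by auto
          ultimately show False
            using 1(1) by blast
        qed
      qed
      then have "\<not> fits 0 0"
        using init by auto
      then show False
        unfolding fits_def by auto
    qed
    then show ?thesis
      using I unfolding won_by_I_def II_obeys_def by blast
  qed
  then show ?thesis
    unfolding I_can_reach_def by blast
qed

text \<open>
  II keeps a position \<open>(t, s)\<close> with \<open>s\<close> in \<open>reach q (promise_targets C L t)\<close> and decreases the rank of \<open>s\<close>
  in this set until a target is hit; then she adds the promised digit to \<open>t\<close> and starts again. As ranks
  cannot decrease forever, \<open>t\<close> grows infinitely often. At the moments of growth \<open>t\<close> and \<open>s\<close> are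
  consistent with \<open>C\<close>, which by assumption puts the outcome into \<open>A\<close>.
\<close>

lemma II_can_reach_by_promises:
  assumes q: "q \<in> P"
    and reach: "\<And>t s. \<lbrakk>s \<in> lists X; (t, s) \<notin> L\<rbrakk> \<Longrightarrow> s \<in> reach q (promise_targets C L t)"
    and init: "([], []) \<notin> L"
    and C: "\<And>x t :: nat \<Rightarrow> nat list. \<lbrakk>\<And>i. \<exists>j\<ge>i. t (Suc j) \<noteq> t j;
        \<And>j. t (Suc j) = t j \<or> (\<exists>n. t (Suc j) = t j @ [n]) \<and> C (t (Suc j)) (map x [0..<Suc j])\<rbrakk> \<Longrightarrow> x \<in> A"
  shows "II_can_reach (gowers_moves q) A"
proof -
  have "\<exists>B. wf {(v, u). v \<in> B u} \<and> (\<forall>u\<in>reach q V. u \<in> reach_step q V (B u)) \<and> (\<forall>u. B u \<subseteq> reach q V)"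
    for V
    using lfp_ranking[OF mono_reach_step[of q V]] unfolding reach_def by metis
  then obtain B where wf: "\<And>V. wf {(v, u). v \<in> B V u}"
    and B: "\<And>V u. u \<in> reach q V \<Longrightarrow> u \<in> reach_step q V (B V u)"
    and B_reach: "\<And>V u. B V u \<subseteq> reach q V"
    by metis
  let ?V = "promise_targets C L"
  define good where "good w \<longleftrightarrow> snd w \<in> reach q (?V (fst w))" for w
  define move where "move w r w' \<longleftrightarrow> (\<exists>x\<in>X. snd w' = snd w @ [x]) \<and> (snd w', r) \<in> tri \<and>
      (fst w' = fst w \<and> snd w' \<in> B (?V (fst w)) (snd w) \<or>
       (\<exists>n. fst w' = fst w @ [n]) \<and> C (fst w') (snd w'))" for w r w'
  have "\<exists>w'. good w' \<and> move w r w'" if w: "good w" and r: "r \<in> gowers_moves q" for w r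
  proof -
    obtain t s where ts: "w = (t, s)"
      by fastforce
    have s: "s \<in> reach_step q (?V t) (B (?V t) s)"
      using B w ts unfolding good_def by auto
    then obtain x where x: "x \<in> X" "(s @ [x], r) \<in> tri" "s @ [x] \<in> ?V t \<union> B (?V t) s"
      using r unfolding reach_step_def gowers_moves_def by blast
    show ?thesis
    proof (cases "s @ [x] \<in> B (?V t) s")
      case True
      then show ?thesis
        using x B_reach ts unfolding good_def move_def
        by (intro exI[of _ "(t, s @ [x])"]) auto
    next
      case False
      then obtain n where n: "C (t @ [n]) (s @ [x])" "(t @ [n], s @ [x]) \<notin> L"
        using x unfolding promise_targets_def by blast
      have "s @ [x] \<in> lists X"
        using s x unfolding reach_step_def by auto
      then have "good (t @ [n], s @ [x])"
        using reach n unfolding good_def by simp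
      then show ?thesis
        using x n ts unfolding move_def by (intro exI[of _ "(t @ [n], s @ [x])"]) auto
    qed
  qed
  then obtain nxt where nxt: "\<And>w r. \<lbrakk>good w; r \<in> gowers_moves q\<rbrakk> \<Longrightarrow> good (nxt w r) \<and> move w r (nxt w r)"
    by metis
  define state where "state = foldl nxt ([], [])"
  \<comment> \<open>A state already contains the answer of II to the last move of I, as the last
      entry of its second component.\<close>
  define \<tau> where "\<tau> ps = last (snd (state ps))" for ps
  have "won_by_II (gowers_moves q) A p x" if x: "\<forall>i. x i = \<tau> (map p [0..<Suc i])" for p x
  proof -
    define w where "w i = state (map p [0..<i])" for i
    have w_Suc: "w (Suc i) = nxt (w i) (p i)" for i
      by (simp add: w_def state_def)
    have w_inv: "good (w i) \<and> snd (w i) = map x [0..<i]" if "\<forall>j<i. I_obeys (gowers_moves q) p j" for i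
      using that
    proof (induction i)
      case 0
      then show ?case
        using reach[of "[]" "[]"] init by (simp add: w_def state_def good_def)
    next
      case (Suc i)
      then have "good (w i)" "snd (w i) = map x [0..<i]" "p i \<in> gowers_moves q"
        by (auto simp: I_obeys_def)
      then have *: "good (w (Suc i))" "move (w i) (p i) (w (Suc i))"
        using nxt w_Suc by auto
      then obtain y where "snd (w (Suc i)) = map x [0..<i] @ [y]"
        unfolding move_def \<open>snd (w i) = _\<close> by blast
      moreover from this have "x i = y"
        using x by (simp add: \<tau>_def w_def)
      ultimately show ?case
        using * by simp
    qed
    have moves: "move (w i) (p i) (w (Suc i))" if "\<forall>j\<le>i. I_obeys (gowers_moves q) p j" for i
      using nxt w_inv[of i] that w_Suc unfolding I_obeys_def by auto
    have obeys: "II_obeys p x i" if "\<forall>j\<le>i. I_obeys (gowers_moves q) p j" for i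
      using moves[OF that] w_inv[of i] w_inv[of "Suc i"] that
      unfolding move_def II_obeys_def by (auto simp: less_Suc_eq_le)
    show ?thesis
    proof (cases "\<forall>i. I_obeys (gowers_moves q) p i")
      case False
      then obtain i where "\<not> I_obeys (gowers_moves q) p i" "\<forall>j<i. I_obeys (gowers_moves q) p j"
        using exists_least_iff[of "\<lambda>i. \<not> I_obeys (gowers_moves q) p i"] by blast
      then show ?thesis
        using obeys unfolding won_by_II_def by (meson le_less_trans)
    next
      case True
      define t where "t i = fst (w i)" for i
      have t_step: "t (Suc i) = t i \<and> map x [0..<Suc i] \<in> B (?V (t i)) (map x [0..<i]) \<or>
          (\<exists>n. t (Suc i) = t i @ [n]) \<and> C (t (Suc i)) (map x [0..<Suc i])" for i
        using moves[of i] w_inv[of i] w_inv[of "Suc i"] True unfolding move_def t_def by metis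
      have "\<exists>j\<ge>i. t (Suc j) \<noteq> t j" for i
      proof (rule ccontr)
        assume "\<not> (\<exists>j\<ge>i. t (Suc j) \<noteq> t j)"
        then have const: "t (Suc j) = t j" if "j \<ge> i" for j
          using that by blast
        then have ti: "t (i + j) = t i" for j
          by (induction j) auto
        have "map x [0..<Suc (i + j)] \<in> B (?V (t i)) (map x [0..<i + j])" for j
          using t_step[of "i + j"] const[of "i + j"] ti[of j] by auto
        then have "(map x [0..<i + Suc j], map x [0..<i + j]) \<in> {(v, u). v \<in> B (?V (t i)) u}" for j
          by simp
        then have "\<exists>h. \<forall>j. (h (Suc j), h j) \<in> {(v, u). v \<in> B (?V (t i)) u}"
          by (intro exI[of _ "\<lambda>j. map x [0..<i + j]"]) blast
        then show False
          using wf[of "?V (t i)"] unfolding wf_iff_no_infinite_down_chain by blast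
      qed
      then have "x \<in> A"
        using C t_step by blast
      then show ?thesis
        using True obeys unfolding won_by_II_def by blast
    qed
  qed
  then show ?thesis
    unfolding II_can_reach_def by blast
qed

text \<open>
  The order of choices matters. First \<open>a\<close> fixes the hopeless set \<open>L\<close> for all \<open>r \<le> a\<close>. Only then are the
  targets of both players determined, those of II from \<open>L\<close> and those of I from the ranks \<open>B\<close>;
  there are countably many, and \<open>q\<close> decides all of them. The ranks belong to \<open>a\<close> and not to \<open>q\<close>,
  but what II cannot do anywhere below \<open>a\<close> she cannot do at \<open>q\<close>.
\<close>

lemma unfolded_dichotomy:
  assumes p: "p \<in> P"
    and I: "\<And>x. x \<in> A \<Longrightarrow> \<exists>\<alpha> :: nat \<Rightarrow> nat. \<forall>k m. C (map \<alpha> [0..<k]) (map x [0..<m])"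
    and II: "\<And>x t :: nat \<Rightarrow> nat list. \<lbrakk>\<And>i. \<exists>j\<ge>i. t (Suc j) \<noteq> t j;
        \<And>j. t (Suc j) = t j \<or> (\<exists>n. t (Suc j) = t j @ [n]) \<and> C (t (Suc j)) (map x [0..<Suc j])\<rbrakk> \<Longrightarrow> x \<in> A"
  shows "\<exists>q\<in>P. (q, p) \<in> le \<and>
      (I_can_reach (asymptotic_moves q) ((UNIV \<rightarrow> X) - A) \<or> II_can_reach (gowers_moves q) A)"
proof -
  obtain a where a: "a \<in> P" "(a, p) \<in> le"
    and decided: "\<And>r. r \<in> P \<Longrightarrow> (r, a) \<in> le \<Longrightarrow> hopeless C r = hopeless C a"
    by (rule hopeless_decided[OF p, of C]) (rule that)
  define L where "L = hopeless C a"
  obtain B where wf: "wf {(v, u). v \<in> B u}" and B: "\<And>u. u \<in> L \<Longrightarrow> u \<in> hopeless_step C a (B u)"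
    and BL: "\<And>u. B u \<subseteq> L"
    by (rule lfp_ranking[OF mono_hopeless_step[of C a], folded hopeless_def, folded L_def]) (rule that)
  define I where "I = (UNIV :: nat list set) \<times> lists X"
  have "countable I"
    using X_countable unfolding I_def by (intro countable_SIGMA countableI_type countable_lists)
  let ?V = "\<lambda>u. promise_targets C (B u) (fst u)"
  let ?\<V> = "range (promise_targets C L) \<union> ?V ` I"
  have "countable ?\<V>"
    using \<open>countable I\<close> by (intro countable_Un countable_image countableI_type)
  obtain q where q: "q \<in> P" "(q, a) \<in> le"
    and stable: "\<And>V s r. \<lbrakk>V \<in> ?\<V>; s \<in> lists X; r \<in> P; (r, q) \<in> le; s \<in> reach r V\<rbrakk> \<Longrightarrow> s \<in> reach q V"
    and avoid: "\<And>V s. \<lbrakk>V \<in> ?\<V>; s \<in> lists X; s \<notin> reach q V\<rbrakk> \<Longrightarrow> \<exists>r\<in>P. lessapprox r q \<and>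
      (\<forall>x\<in>X. (s @ [x], r) \<in> tri \<longrightarrow> s @ [x] \<notin> V \<and> s @ [x] \<notin> reach q V)"
    by (rule reach_or_avoid[OF \<open>countable ?\<V>\<close> a(1)]) (rule that)
  have qp: "(q, p) \<in> le"
    using q a le_trans by blast
  have Lq: "hopeless C q = L"
    using decided q L_def by blast
  show ?thesis
  proof (cases "([], []) \<in> L")
    case True
    have "I_can_reach (asymptotic_moves q) ((UNIV \<rightarrow> X) - A)"
    proof (rule I_can_reach_by_avoiding[OF q(1) wf _ BL _ True I])
      show "s \<notin> reach q (promise_targets C (B (t, s)) t)" if "(t, s) \<in> L" for t s
        using B[OF that] q unfolding hopeless_step_def by blast
      show "\<exists>r\<in>P. lessapprox r q \<and>
          (\<forall>x\<in>X. (s @ [x], r) \<in> tri \<longrightarrow> s @ [x] \<notin> ?V u \<and> s @ [x] \<notin> reach q (?V u))"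
        if "snd u \<in> lists X" "s \<in> lists X" "s \<notin> reach q (?V u)" for u s
      proof -
        have "?V u \<in> ?\<V>"
          using that(1) by (auto simp: I_def mem_Times_iff)
        then show ?thesis
          by (rule avoid[OF _ that(2,3)])
      qed
    qed
    then show ?thesis
      using q(1) qp by blast
  next
    case False
    have "s \<in> reach q (promise_targets C L t)" if s: "s \<in> lists X" and "(t, s) \<notin> L" for t s
    proof -
      have "(t, s) \<notin> hopeless_step C q L"
        using that(2) hopeless_unfold[of C q] Lq by simp
      then obtain r where "r \<in> P" "(r, q) \<in> le" "s \<in> reach r (promise_targets C L t)"
        unfolding hopeless_step_def by blast
      then show ?thesis
        using stable s by blast
    qed
    then have "II_can_reach (gowers_moves q) A"
      by (rule II_can_reach_by_promises[OF q(1) _ False II])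
    then show ?thesis
      using q(1) qp by blast
  qed
qed

lemma strategically_Ramsey_empty: "strategically_Ramsey {}"
proof -
  have "I_can_reach (asymptotic_moves p) ((UNIV \<rightarrow> X) - {})" if "p \<in> P" for p
    unfolding I_can_reach_def
  proof (intro exI[of _ "\<lambda>_. p"] allI impI)
    fix ps :: "nat \<Rightarrow> 'p" and x :: "nat \<Rightarrow> 'x"
    assume "\<forall>i. ps i = p"
    then have "\<forall>i. I_obeys (asymptotic_moves p) ps i"
      using that le_refl les_refl by (simp add: I_obeys_def asymptotic_moves_def lessapprox_def)
    moreover have "x \<in> UNIV \<rightarrow> X" if "\<forall>i. II_obeys ps x i"
      using that by (auto simp: II_obeys_def)
    ultimately show "won_by_I (asymptotic_moves p) ((UNIV \<rightarrow> X) - {}) ps x"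
      unfolding won_by_I_def by blast
  qed
  then show ?thesis
    unfolding strategically_Ramsey_def using le_refl by blast
qed

end

section \<open>Continuous images of the Baire space\<close>

lemma continuous_map_seq_topology_digits:
  fixes f :: "(nat \<Rightarrow> 'a) \<Rightarrow> nat \<Rightarrow> 'x"
  assumes f: "continuous_map (seq_topology UNIV) (seq_topology X) f"
  shows "\<exists>m. \<forall>\<beta>. (\<forall>i<m. \<beta> i = \<alpha> i) \<longrightarrow> f \<beta> k = f \<alpha> k"
proof -
  have "continuous_map (seq_topology UNIV) (discrete_topology X) (\<lambda>\<alpha>. f \<alpha> k)"
    using f unfolding seq_topology_def by (simp add: continuous_map_componentwise_UNIV)
  then have "openin (seq_topology UNIV) {\<beta>. f \<beta> k = f \<alpha> k}" and "f \<alpha> k \<in> X"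
    unfolding continuous_map_def by (auto simp: seq_topology_def Pi_iff dest!: spec[of _ "{f \<alpha> k}"])
  then obtain U where U: "finite {i. U i \<noteq> UNIV}" "\<alpha> \<in> Pi\<^sub>E UNIV U" "Pi\<^sub>E UNIV U \<subseteq> {\<beta>. f \<beta> k = f \<alpha> k}"
    unfolding seq_topology_def openin_product_topology_alt by auto
  obtain m where m: "{i. U i \<noteq> UNIV} \<subseteq> {..<m}"
    using U(1) finite_nat_iff_bounded by blast
  have "f \<beta> k = f \<alpha> k" if \<beta>: "\<forall>i<m. \<beta> i = \<alpha> i" for \<beta>
  proof -
    have "\<beta> i \<in> U i" for i
    proof (cases "i < m")
      case True
      then show ?thesis
        using U(2) \<beta> by (auto simp: PiE_iff)
    next
      case False
      then show ?thesis
        using m by auto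
    qed
    then show ?thesis
      using U(3) by auto
  qed
  then show ?thesis
    by blast
qed

definition initial_segment :: "(nat \<Rightarrow> 'a) \<Rightarrow> 'a list \<Rightarrow> bool"
  where "initial_segment \<alpha> t \<longleftrightarrow> map \<alpha> [0..<length t] = t"

text \<open>
  The digits \<open>t j\<close> converge to some \<open>\<alpha>\<close>. At each moment of growth there is a \<open>\<beta>\<close> that agrees with \<open>\<alpha>\<close> on
  \<open>t\<close> and whose image agrees with \<open>x\<close> so far; continuity of \<open>f\<close> at \<open>\<alpha>\<close> carries this over to \<open>f \<alpha> = x\<close>.
\<close>

lemma limit_of_growing_promises:
  fixes t :: "nat \<Rightarrow> 'a list" and f :: "(nat \<Rightarrow> 'a) \<Rightarrow> nat \<Rightarrow> 'x"
  assumes f: "continuous_map (seq_topology UNIV) (seq_topology X) f"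
    and grows: "\<And>i. \<exists>j\<ge>i. t (Suc j) \<noteq> t j"
    and step: "\<And>j. t (Suc j) = t j \<or> (\<exists>n. t (Suc j) = t j @ [n]) \<and>
      (\<exists>\<beta>. initial_segment \<beta> (t (Suc j)) \<and> initial_segment (f \<beta>) (map x [0..<Suc j]))"
  shows "x \<in> range f"
proof -
  have prefix: "take (length (t i)) (t (i + d)) = t i" for i d
  proof (induction d)
    case (Suc d)
    have "length (t i) \<le> length (t (i + d))"
      using Suc by (metis length_take min.cobounded1 min.commute)
    then show ?case
      using Suc step[of "i + d"] by auto
  qed simp
  have long: "\<exists>i. length (t i) > k" for k
  proof (induction k)
    case 0
    obtain j where "t (Suc j) \<noteq> t j"
      using grows by blast
    then show ?case
      using step[of j] by (intro exI[of _ "Suc j"]) auto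
  next
    case (Suc k)
    then obtain i where i: "length (t i) > k"
      by blast
    obtain j where j: "j \<ge> i" "t (Suc j) \<noteq> t j"
      using grows by blast
    have "length (t i) \<le> length (t j)"
      using prefix[of i "j - i"] j(1) by (metis le_add_diff_inverse length_take min.cobounded1 min.commute)
    then show ?case
      using i j(2) step[of j] by (intro exI[of _ "Suc j"]) auto
  qed
  obtain pos where pos: "\<And>k. length (t (pos k)) > k"
    using long by metis
  define \<alpha> where "\<alpha> k = t (pos k) ! k" for k
  have nth: "t i ! k = \<alpha> k" if "k < length (t i)" for i k
  proof -
    have "t i ! k = t (i + pos k) ! k"
      using prefix[of i "pos k"] that by (metis nth_take)
    also have "\<dots> = t (pos k) ! k"
      using prefix[of "pos k" i] pos by (metis add.commute nth_take)
    finally show ?thesis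
      by (simp add: \<alpha>_def)
  qed
  have "f \<alpha> k = x k" for k
  proof -
    obtain m where m: "\<And>\<beta>. (\<forall>i<m. \<beta> i = \<alpha> i) \<Longrightarrow> f \<beta> k = f \<alpha> k"
      using continuous_map_seq_topology_digits[OF f] by blast
    obtain j where j: "j \<ge> k + pos m" "t (Suc j) \<noteq> t j"
      using grows by blast
    then obtain \<beta> where \<beta>: "initial_segment \<beta> (t (Suc j))" "initial_segment (f \<beta>) (map x [0..<Suc j])"
      using step[of j] by blast
    have "length (t (pos m)) \<le> length (t (Suc j))"
      using prefix[of "pos m" "Suc j - pos m"] j(1)
      by (metis add_leD2 le_SucI le_add_diff_inverse length_take min.cobounded1 min.commute)
    then have "\<beta> i = \<alpha> i" if "i < m" for i
      using that pos[of m] \<beta>(1) nth[of i "Suc j"] unfolding initial_segment_def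
      by (metis add_0 diff_zero less_trans nth_map_upt order_less_le_trans)
    then have "f \<alpha> k = f \<beta> k"
      using m by metis
    also have "\<dots> = x k"
      using \<beta>(2) j(1) by (cases "k = j") (auto simp: initial_segment_def dest: bspec[of _ _ k])
    finally show ?thesis .
  qed
  then have "x = f \<alpha>"
    by auto
  then show ?thesis
    by blast
qed

theorem theorem3p3:
  fixes P :: "'p set" and X :: "'x set"
    and le les :: "'p rel" and tri :: "('x list \<times> 'p) set"
    and A :: "(nat \<Rightarrow> 'x) set"
  assumes "gowers_space P X le les tri"
    and "analytic_in (seq_topology X) A"
  shows "gowers_space.strategically_Ramsey P X le les tri A"
proof -
  interpret gowers_space P X le les tri
    by (rule assms(1))
  show ?thesis
  proof (cases "A = {}")
    case True
    then show ?thesis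
      using strategically_Ramsey_empty by simp
  next
    case False
    then obtain f where f: "continuous_map (seq_topology (UNIV :: nat set)) (seq_topology X) f"
      and "A = f ` topspace (seq_topology (UNIV :: nat set))"
      using assms(2) unfolding analytic_in_def by blast
    then have A: "A = range f"
      by (simp add: seq_topology_def)
    define C where "C t s \<longleftrightarrow> (\<exists>\<beta>. initial_segment \<beta> t \<and> initial_segment (f \<beta>) s)" for t s
    show ?thesis
      unfolding strategically_Ramsey_def
    proof
      fix p
      assume "p \<in> P"
      then show "\<exists>q\<in>P. (q, p) \<in> le \<and>
          (I_can_reach (asymptotic_moves q) ((UNIV \<rightarrow> X) - A) \<or> II_can_reach (gowers_moves q) A)"
      proof (rule unfolded_dichotomy)
        show "\<exists>\<alpha>. \<forall>k m. C (map \<alpha> [0..<k]) (map x [0..<m])" if "x \<in> A" for x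
          using that unfolding A C_def initial_segment_def by auto
        show "x \<in> A" if "\<And>i. \<exists>j\<ge>i. t (Suc j) \<noteq> t j"
          "\<And>j. t (Suc j) = t j \<or> (\<exists>n. t (Suc j) = t j @ [n]) \<and> C (t (Suc j)) (map x [0..<Suc j])"
          for x t
          using limit_of_growing_promises[OF f that(1)] that(2) unfolding A C_def by blast
      qed
    qed
  qed
qed

end
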